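(* Let $K$ be an integer and let $A$ be a finite set of positive integers with $|AA|\leq K|A|$, where $|A|$ is sufficiently large (in terms of $K$). Let $k\geq 1$ be an integer. Then for any integer $u$ coprime with every element of $A$, $$\Lambda_k(A+u)\leq (2k^2)^K,$$ and in particular $$|(A+u)^{(k)}|\geq \frac{|A|^k}{(2k^2)^{kK}}.$$
   Context: $AA=\{ab: a,b\in A\}$, $A+u=\{a+u:a\in A\}$, and $B^{(k)}=\{b_1\cdots b_k: b_i\in B\}$. For a finite set $B=\{b_1,\dots,b_N\}$ and non-negative real weights $w=(w_1,\dots,w_N)$, $E_{k,w}(B)=\sum w_{i_1}\cdots w_{i_{2k}}$, summing over all $2k$-tuples of indices with $b_{i_1}\cdots b_{i_k}=b_{i_{k+1}}\cdots b_{i_{2k}}$; $\Lambda_k(B)=\max_w E_{k,w}(B)^{1/k}$ over all non-negative weights with $\sum_i w_i^2=1$.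
   Formalization: The bound on Λ_k(A+u) is proved only when 0 is not in A+u, i.e. excluding u = -1 with 1 in A, where it fails (e.g. A = {1,2,4,...,2^(n-1)}, K = k = 2, n large); the lower bound for |(A+u)^(k)| is proved for every u. *)

theory Defs
  imports "HOL-Analysis.Analysis"
begin

definition product_set :: "'a::comm_monoid_mult set \<Rightarrow> 'a set" where
  "product_set A = {a * b | a b. a \<in> A \<and> b \<in> A}"

definition shift_set :: "'a::plus set \<Rightarrow> 'a \<Rightarrow> 'a set" where
  "shift_set A u = (\<lambda>a. a + u) ` A"

definition iterated_product_set :: "'a::comm_monoid_mult set \<Rightarrow> nat \<Rightarrow> 'a set" where
  "iterated_product_set B k = {\<Prod>i<k. b i | b. \<forall>i<k. b i \<in> B}"

text \<open>
  The weights are indexed by the elements of \<open>B\<close> themselves instead of by an enumeration of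
  \<open>B\<close>. A \<open>2k\<close>-tuple is an extensional function on \<open>{..<2*k}\<close>; its first \<open>k\<close> entries form
  the left-hand side of the multiplicative equation and its last \<open>k\<close> entries the right-hand side.
\<close>

definition weighted_energy :: "nat \<Rightarrow> ('a::comm_monoid_mult \<Rightarrow> real) \<Rightarrow> 'a set \<Rightarrow> real" where
  "weighted_energy k w B =
     (\<Sum>b \<in> {b \<in> {..<2*k} \<rightarrow>\<^sub>E B. (\<Prod>i<k. b i) = (\<Prod>i=k..<2*k. b i)}. \<Prod>i<2*k. w (b i))"

definition unit_weights :: "'a set \<Rightarrow> ('a \<Rightarrow> real) set" where
  "unit_weights B = {w. (\<forall>b\<in>B. 0 \<le> w b) \<and> (\<Sum>b\<in>B. (w b)\<^sup>2) = 1}"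

definition Lambda_const :: "nat \<Rightarrow> 'a::comm_monoid_mult set \<Rightarrow> real" where
  "Lambda_const k B = (SUP w \<in> unit_weights B. weighted_energy k w B powr (1 / real k))"

text \<open>For finite nonempty \<open>B\<close> the supremum above is a maximum.\<close>

lemma weighted_energy_cong:
  assumes "\<And>b. b \<in> B \<Longrightarrow> w b = w' b"
  shows "weighted_energy k w B = weighted_energy k w' B"
  unfolding weighted_energy_def
  by (intro sum.cong refl prod.cong) (auto intro!: assms simp: PiE_iff)

lemma weighted_energy_nonneg:
  assumes "\<And>b. b \<in> B \<Longrightarrow> 0 \<le> w b"
  shows "0 \<le> weighted_energy k w B"
  unfolding weighted_energy_def
  by (intro sum_nonneg prod_nonneg) (auto intro!: assms simp: PiE_iff)

lemma Lambda_const_is_max: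
  fixes B :: "'a::comm_monoid_mult set"
  assumes "finite B" "B \<noteq> {}"
  shows "\<exists>w\<in>unit_weights B. Lambda_const k B = weighted_energy k w B powr (1 / real k) \<and>
           (\<forall>v\<in>unit_weights B.
              weighted_energy k v B powr (1 / real k) \<le> weighted_energy k w B powr (1 / real k))"
proof -
  define P :: "('a \<Rightarrow> real) set" where
    "P = (\<Pi>\<^sub>E b\<in>UNIV. if b \<in> B then {0..1} else {0})"
  define C where "C = P \<inter> {w. (\<Sum>b\<in>B. (w b)\<^sup>2) = 1}"
  have P: "compact P"
  proof -
    have "compactin (product_topology (\<lambda>b::'a. euclidean :: real topology) UNIV) P"
      unfolding P_def by (subst compactin_PiE) auto
    then show ?thesis
      unfolding euclidean_product_topology compactin_euclidean_iff .
  qed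
  have coord: "continuous_on UNIV (\<lambda>w :: 'a \<Rightarrow> real. w b)" for b
    by (rule continuous_on_product_coordinates)
  have "closed {w :: 'a \<Rightarrow> real. (\<Sum>b\<in>B. (w b)\<^sup>2) = 1}"
    by (intro closed_Collect_eq continuous_intros coord)
  then have C: "compact C"
    unfolding C_def using P by (rule compact_Int_closed[rotated])
  have C_sub: "C \<subseteq> unit_weights B"
    unfolding C_def P_def unit_weights_def by (auto simp: PiE_iff split: if_splits)
  have trunc: "(\<lambda>b. if b \<in> B then w b else 0) \<in> C" if w: "w \<in> unit_weights B" for w
  proof -
    have "w b \<le> 1" if "b \<in> B" for b
    proof -
      have "(w b)\<^sup>2 \<le> (\<Sum>b\<in>B. (w b)\<^sup>2)"
        using that assms by (intro member_le_sum) auto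
      also have "\<dots> = 1" using w by (simp add: unit_weights_def)
      finally show ?thesis using abs_square_le_1[of "w b"] by linarith
    qed
    moreover have "(\<Sum>b\<in>B. (if b \<in> B then w b else 0)\<^sup>2) = 1"
      using w by (simp add: unit_weights_def cong: sum.cong)
    ultimately show ?thesis
      using w unfolding C_def P_def unit_weights_def by (auto simp: PiE_iff)
  qed
  obtain b0 where b0: "b0 \<in> B" using assms by blast
  have "(\<lambda>b. if b = b0 then 1 else 0) \<in> unit_weights B"
    using b0 assms by (simp add: unit_weights_def if_distrib[of "\<lambda>x. x\<^sup>2"] cong: if_cong)
  then have "C \<noteq> {}" using trunc by blast
  moreover have "continuous_on C (\<lambda>w. weighted_energy k w B)"
    unfolding weighted_energy_def
    by (intro continuous_on_sum continuous_on_prod continuous_on_subset[OF coord]) auto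
  ultimately obtain w where w: "w \<in> C"
    and wmax: "\<And>v. v \<in> C \<Longrightarrow> weighted_energy k v B \<le> weighted_energy k w B"
    using continuous_attains_sup[OF C] by blast
  have max: "weighted_energy k v B powr (1 / real k) \<le> weighted_energy k w B powr (1 / real k)"
    if v: "v \<in> unit_weights B" for v
  proof (rule powr_mono2)
    show "0 \<le> weighted_energy k v B"
      using v by (intro weighted_energy_nonneg) (simp add: unit_weights_def)
    have "weighted_energy k v B = weighted_energy k (\<lambda>b. if b \<in> B then v b else 0) B"
      by (rule weighted_energy_cong) simp
    also have "\<dots> \<le> weighted_energy k w B" by (rule wmax[OF trunc[OF v]])
    finally show "weighted_energy k v B \<le> weighted_energy k w B" .
  qed simp
  have "Lambda_const k B = weighted_energy k w B powr (1 / real k)"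
    unfolding Lambda_const_def
    by (rule cSup_eq_maximum) (use w C_sub max in auto)
  then show ?thesis using w C_sub max by blast
qed

end

theory Submission
  imports
    Defs
    "HOL-Library.Function_Algebras"
    "HOL-Library.Poly_Mapping"
    "HOL-Library.Z2"
begin

text \<open>
  A multiplicative version of Freiman's lemma shows that the prime exponent vectors of \<open>A\<close> span an
  affine space of dimension \<open>d < K\<close>: remove the minimum \<open>a\<close> of \<open>A\<close>; among the products that are lost
  are \<open>a\<^sup>2\<close> and all \<open>a b\<close> with \<open>b / a\<close> irreducible among the ratios, and the irreducible ratios
  generate all of them. Hence \<open>d\<close> primes suffice to separate the elements of \<open>A\<close> by their
  valuations.

  Now split \<open>A\<close> by the valuation at one prime \<open>p\<close>. In a solution of
  \<open>(a\<^sub>1 + u) \<cdots> (a\<^sub>k + u) = (a\<^bsub>k+1\<^esub> + u) \<cdots> (a\<^bsub>2k\<^esub> + u)\<close> the smallest valuation is attained at least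
  twice: otherwise, modulo the next power of \<open>p\<close>, all factors but one would be congruent to the unit
  \<open>u\<close>, and then so would be the last one. Summing over the at most \<open>2 k\<^sup>2\<close> pairs of positions and
  applying Hoelder's inequality shows that \<open>\<Lambda>\<^sub>k(A + u)\<close> is at most \<open>2 k\<^sup>2\<close> times the largest
  constant of the parts. After \<open>d\<close> primes the parts are singletons, whose constant is \<open>1\<close>.

  Hoelder's inequality needs no Fourier analysis: nonzero integers embed into an abelian group via
  exponents and sign, energies are coefficients at \<open>0\<close> of products in its real group ring, and
  there the inequality follows from log-convexity, that is from Cauchy--Schwarz.
\<close>

subsection \<open>Freiman's lemma for product sets\<close>

lemma finite_product_set: "finite A \<Longrightarrow> finite (product_set A)"
proof -
  have "product_set A = (\<lambda>(a, b). a * b) ` (A \<times> A)"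
    unfolding product_set_def by auto
  then show "finite A \<Longrightarrow> finite (product_set A)" by simp
qed

text \<open>Irreducible among the ratios \<open>b / Min A\<close> with \<open>b \<in> A - {Min A}\<close>, all of which exceed \<open>1\<close>.\<close>
definition irreducibles :: "'a::linordered_semidom set \<Rightarrow> 'a set" where
  "irreducibles A = {b \<in> A - {Min A}. Min A * b \<notin> product_set (A - {Min A})}"

lemma irreducibles_subset: "irreducibles A \<subseteq> A - {Min A}"
  unfolding irreducibles_def by blast

lemma Min_less:
  fixes A :: "'a::linorder set"
  assumes "finite A" "b \<in> A - {Min A}"
  shows "Min A < b"
  using assms Min_le[of A b] by (simp add: order.strict_iff_order) blast

lemma card_product_set_remove_Min:
  fixes A :: "'a::linordered_semidom set"
  assumes A: "finite A" "A \<noteq> {}" "\<And>b. b \<in> A \<Longrightarrow> 0 < b"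
  shows "card (product_set (A - {Min A})) + card (irreducibles A) + 1 \<le> card (product_set A)"
proof -
  define a where "a = Min A"
  have a: "a \<in> A" "0 < a" using A by (auto simp: a_def)
  have fin: "finite (irreducibles A)"
    using A(1) irreducibles_subset by (rule rev_finite_subset[OF finite_Diff])
  have "a * a \<notin> product_set (A - {a})"
  proof
    assume "a * a \<in> product_set (A - {a})"
    then obtain x y where "x \<in> A - {a}" "y \<in> A - {a}" "a * a = x * y"
      unfolding product_set_def by blast
    moreover from this have "a < x" "a < y"
      using Min_less[OF A(1)] unfolding a_def by blast+
    then have "a * a < x * y" using a(2) by (intro mult_strict_mono) auto
    ultimately show False by simp
  qed
  then have disjoint: "product_set (A - {a}) \<inter> (*) a ` insert a (irreducibles A) = {}"
    unfolding irreducibles_def a_def by auto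
  have "strict_mono ((*) a)" using a(2) by (simp add: strict_mono_def mult_strict_left_mono)
  then have inj: "inj ((*) a)" by (rule strict_mono_imp_inj_on)
  have "card (product_set (A - {a})) + card (irreducibles A) + 1 =
      card (product_set (A - {a})) + card ((*) a ` insert a (irreducibles A))"
    using fin irreducibles_subset[of A]
    by (subst card_image[OF inj_on_subset[OF inj subset_UNIV]]) (auto simp: card_insert_if a_def)
  also have "\<dots> = card (product_set (A - {a}) \<union> (*) a ` insert a (irreducibles A))"
    using disjoint fin A(1) by (subst card_Un_disjoint) (auto intro: finite_product_set)
  also have "\<dots> \<le> card (product_set A)"
    using A(1) a(1) irreducibles_subset[of A]
    by (intro card_mono finite_product_set) (auto simp: product_set_def)
  finally show ?thesis unfolding a_def .
qed

locale log_map = vector_space scale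
  for scale :: "'k::field \<Rightarrow> 'v::ab_group_add \<Rightarrow> 'v" +
  fixes lg :: "'a::linordered_semidom \<Rightarrow> 'v"
  assumes log_mult: "0 < a \<Longrightarrow> 0 < b \<Longrightarrow> lg (a * b) = lg a + lg b"
begin

definition mult_dim :: "'a set \<Rightarrow> nat" where
  "mult_dim A = dim ((\<lambda>(a, b). lg a - lg b) ` (A \<times> A))"

lemma mult_dim_le_card:
  assumes "finite T" "\<And>b. b \<in> A \<Longrightarrow> lg b - lg a \<in> span T"
  shows "mult_dim A \<le> card T"
  unfolding mult_dim_def
proof (rule dim_le_card[OF _ assms(1)], clarify)
  fix b c assume "b \<in> A" "c \<in> A"
  then have "(lg b - lg a) - (lg c - lg a) \<in> span T" by (intro span_diff assms(2))
  then show "lg b - lg c \<in> span T" by simp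
qed

lemma obtain_spanning_logs:
  assumes "finite A"
  obtains T where "finite T" "card T = mult_dim A"
    "\<And>a b. a \<in> A \<Longrightarrow> b \<in> A \<Longrightarrow> lg a - lg b \<in> span T"
proof -
  obtain T where T: "T \<subseteq> (\<lambda>(a, b). lg a - lg b) ` (A \<times> A)"
    "(\<lambda>(a, b). lg a - lg b) ` (A \<times> A) \<subseteq> span T" "card T = mult_dim A"
    unfolding mult_dim_def using basis_exists .
  have "finite T" using T(1) assms by (auto intro: finite_subset)
  moreover have "lg a - lg b \<in> span T" if "a \<in> A" "b \<in> A" for a b
    using T(2) that by force
  ultimately show ?thesis using T(3) that by blast
qed

lemma mult_dim_mono:
  assumes "finite B" "A \<subseteq> B"
  shows "mult_dim A \<le> mult_dim B"
proof (cases "A = {}")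
  case True
  then show ?thesis using mult_dim_le_card[of "{}" A] by simp
next
  case False
  then obtain a where "a \<in> A" by blast
  moreover obtain T where "finite T" "card T = mult_dim B"
    "\<And>a b. a \<in> B \<Longrightarrow> b \<in> B \<Longrightarrow> lg a - lg b \<in> span T"
    using obtain_spanning_logs[OF assms(1)] by blast
  ultimately show ?thesis using mult_dim_le_card[of T A a] assms(2) by (metis subsetD)
qed

lemma mult_dim_insert_le:
  assumes "finite A"
  shows "mult_dim (insert a A) \<le> Suc (mult_dim A)"
proof (cases "A = {}")
  case True
  then show ?thesis using mult_dim_le_card[of "{}" "{a}" a] by (simp add: span_zero)
next
  case False
  then obtain c where c: "c \<in> A" by blast
  obtain T where T: "finite T" "card T = mult_dim A"
    "\<And>a b. a \<in> A \<Longrightarrow> b \<in> A \<Longrightarrow> lg a - lg b \<in> span T"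
    using obtain_spanning_logs[OF assms] by blast
  have "lg b - lg c \<in> span (insert (lg a - lg c) T)" if "b \<in> insert a A" for b
    using that T(3)[OF _ c] span_mono[OF subset_insertI, of T] by (auto intro: span_base)
  then have "mult_dim (insert a A) \<le> card (insert (lg a - lg c) T)"
    using T(1) by (intro mult_dim_le_card) auto
  also have "\<dots> \<le> Suc (mult_dim A)" using T by (simp add: card_insert_if)
  finally show ?thesis .
qed

lemma mult_dim_insert_product:
  assumes A: "finite A" "\<And>x. x \<in> insert a A \<Longrightarrow> 0 < x"
    and b: "b \<in> A" and ab: "a * b \<in> product_set A"
  shows "mult_dim (insert a A) \<le> mult_dim A"
proof -
  obtain x y where xy: "x \<in> A" "y \<in> A" "a * b = x * y"
    using ab unfolding product_set_def by blast
  then have "lg a + lg b = lg x + lg y"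
    using A(2) b by (metis insertCI log_mult)
  then have log_a: "lg a - lg x = lg y - lg b" by (simp add: algebra_simps)
  obtain T where T: "finite T" "card T = mult_dim A"
    "\<And>a b. a \<in> A \<Longrightarrow> b \<in> A \<Longrightarrow> lg a - lg b \<in> span T"
    using obtain_spanning_logs[OF A(1)] by blast
  have "lg c - lg x \<in> span T" if "c \<in> insert a A" for c
    using that T(3) xy b log_a by auto
  then show ?thesis using mult_dim_le_card[OF T(1)] T(2) by metis
qed

lemma log_diff_Min_in_span_irreducibles:
  assumes A: "finite A" "\<And>b. b \<in> A \<Longrightarrow> 0 < b" and b: "b \<in> A"
  shows "lg b - lg (Min A) \<in> span ((\<lambda>b. lg b - lg (Min A)) ` irreducibles A)" (is "_ \<in> ?V")
  using b
proof (induction "card {x \<in> A. x < b}" arbitrary: b rule: less_induct)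
  case less
  let ?a = "Min A"
  have "?a \<in> A" using A(1) less.prems by (intro Min_in) auto
  then have pos: "0 < ?a" "0 < b" using A(2) less.prems by auto
  consider (minimum) "b = ?a" | (irreducible) "b \<in> irreducibles A"
    | (product) "?a * b \<in> product_set (A - {?a})"
    using less.prems unfolding irreducibles_def by blast
  then show ?case
  proof cases
    case product
    then obtain x y where xy: "x \<in> A - {?a}" "y \<in> A - {?a}" "?a * b = x * y"
      unfolding product_set_def by blast
    then have "?a < x" "?a < y" using Min_less[OF A(1)] by blast+
    then have "x < b" "y < b"
      using xy(3) pos mult_le_less_imp_less[of b x ?a y] mult_less_le_imp_less[of ?a x b y]
      by (force simp: mult.commute not_less[symmetric])+
    then have "card {z \<in> A. z < x} < card {z \<in> A. z < b}"
      "card {z \<in> A. z < y} < card {z \<in> A. z < b}"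
      using xy(1,2) A(1) by (auto intro!: psubset_card_mono)
    then have "(lg x - lg ?a) + (lg y - lg ?a) \<in> ?V"
      using less.hyps xy(1,2) by (intro span_add) auto
    also have "(lg x - lg ?a) + (lg y - lg ?a) = lg b - lg ?a"
    proof -
      have "lg ?a + lg b = lg x + lg y"
        using xy A(2) pos by (metis DiffD1 log_mult)
      then show ?thesis by (simp add: algebra_simps)
    qed
    finally show ?thesis .
  qed (auto intro: span_base span_zero)
qed

lemma mult_dim_le_card_irreducibles:
  assumes "finite A" "\<And>b. b \<in> A \<Longrightarrow> 0 < b"
  shows "mult_dim A \<le> card (irreducibles A)"
proof -
  have fin: "finite (irreducibles A)"
    using assms(1) irreducibles_subset by (rule rev_finite_subset[OF finite_Diff])
  then have "mult_dim A \<le> card ((\<lambda>b. lg b - lg (Min A)) ` irreducibles A)"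
    using log_diff_Min_in_span_irreducibles[OF assms] by (intro mult_dim_le_card) auto
  also have "\<dots> \<le> card (irreducibles A)" using fin by (rule card_image_le)
  finally show ?thesis .
qed

lemma mult_dim_less_card:
  assumes A: "finite A" "A \<noteq> {}" "\<And>b. b \<in> A \<Longrightarrow> 0 < b"
  shows "mult_dim A < card A"
proof -
  have "mult_dim A \<le> card (irreducibles A)"
    using A by (intro mult_dim_le_card_irreducibles)
  also have "\<dots> \<le> card (A - {Min A})"
    using A(1) by (intro card_mono irreducibles_subset) auto
  also have "\<dots> < card A" using card_Diff1_less[OF A(1) Min_in[OF A(1,2)]] .
  finally show ?thesis .
qed

theorem freiman_product_set:
  assumes "finite A" "\<And>b. b \<in> A \<Longrightarrow> 0 < b"
  shows "2 * (mult_dim A + 1) * card A \<le> 2 * card (product_set A) + mult_dim A * (mult_dim A + 1)"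
  using assms
proof (induction "card A" arbitrary: A)
  case 0
  then show ?case by simp
next
  case (Suc n)
  define a where "a = Min A"
  define B where "B = A - {a}"
  have "A \<noteq> {}" using Suc.hyps(2) by auto
  then have A: "A = insert a B" "a \<notin> B" using Min_in[OF Suc.prems(1)] by (auto simp: a_def B_def)
  have B: "finite B" "\<And>b. b \<in> B \<Longrightarrow> 0 < b" "card B = n"
    using Suc.prems Suc.hyps(2) unfolding A(1) using A(2) by auto
  have IH: "2 * (mult_dim B + 1) * n \<le> 2 * card (product_set B) + mult_dim B * (mult_dim B + 1)"
    using Suc.hyps(1)[of B] B by auto
  have growth: "card (product_set B) + card (irreducibles A) + 1 \<le> card (product_set A)"
    using card_product_set_remove_Min[OF Suc.prems(1) \<open>A \<noteq> {}\<close> Suc.prems(2)]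
    unfolding B_def a_def .
  have "mult_dim B \<le> mult_dim A" "mult_dim A \<le> Suc (mult_dim B)"
    using mult_dim_mono[of A B] mult_dim_insert_le[OF B(1), of a] Suc.prems(1) A(1) by auto
  then consider (equal) "mult_dim A = mult_dim B" | (larger) "mult_dim A = Suc (mult_dim B)"
    by linarith
  then show ?case
  proof cases
    case equal
    then have "card (product_set B) + mult_dim B + 1 \<le> card (product_set A)"
      using growth mult_dim_le_card_irreducibles[OF Suc.prems] by linarith
    then show ?thesis using IH equal Suc.hyps(2)[symmetric] by (simp add: algebra_simps)
  next
    case larger
    have "a * b \<notin> product_set B" if "b \<in> B" for b
      using mult_dim_insert_product[OF B(1) _ that, of a] Suc.prems(2) larger
      unfolding A(1) by auto
    then have "irreducibles A = B" unfolding irreducibles_def B_def a_def by blast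
    then have "card (product_set B) + n + 1 \<le> card (product_set A)" using growth B(3) by simp
    then show ?thesis using IH larger Suc.hyps(2)[symmetric] by (simp add: algebra_simps)
  qed
qed

corollary mult_dim_less_doubling:
  fixes K :: int
  assumes A: "finite A" "\<And>b. b \<in> A \<Longrightarrow> 0 < b"
    and doubling: "int (card (product_set A)) \<le> K * int (card A)"
    and large: "2 * K\<^sup>2 < int (card A)"
  shows "int (mult_dim A) < K"
proof (rule ccontr)
  assume "\<not> int (mult_dim A) < K"
  define d n where "d = int (mult_dim A)" and "n = int (card A)"
  have n: "0 < n" using large zero_le_power2[of K] unfolding n_def by linarith
  then have "A \<noteq> {}" unfolding n_def by auto
  then have d: "K \<le> d" "0 \<le> d" "d + 1 \<le> n"
    using mult_dim_less_card[OF A(1) _ A(2)] \<open>\<not> int (mult_dim A) < K\<close>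
    unfolding d_def n_def by auto
  have "2 * (d + 1) * n \<le> 2 * int (card (product_set A)) + d * (d + 1)"
    using iffD2[OF zle_int freiman_product_set[OF A]]
    unfolding d_def n_def by (simp add: algebra_simps)
  then have freiman: "2 * (d + 1) * n \<le> 2 * K * n + d * (d + 1)"
    using doubling unfolding n_def by linarith
  also have "d * (d + 1) \<le> d * n" using d by (intro mult_left_mono) auto
  finally have "(2 * (d + 1)) * n \<le> (2 * K + d) * n" by (simp add: algebra_simps)
  then have "d + 2 \<le> 2 * K" using n by simp
  then have "d * (d + 1) \<le> (2 * K) * (2 * K)" using d by (intro mult_mono) auto
  moreover have "2 * K * n \<le> 2 * d * n" using n d by (intro mult_right_mono) auto
  ultimately have "2 * n \<le> 4 * K\<^sup>2"
    using freiman by (simp add: algebra_simps power2_eq_square)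
  then show False using large unfolding n_def by simp
qed

end

subsection \<open>Separating exponent vectors by few primes\<close>

definition fun_scale :: "'k::field \<Rightarrow> ('i \<Rightarrow> 'k) \<Rightarrow> 'i \<Rightarrow> 'k" where
  "fun_scale c f = (\<lambda>i. c * f i)"

interpretation fun_space: vector_space fun_scale
  by standard (simp_all add: fun_scale_def fun_eq_iff algebra_simps)

definition determining :: "'i set \<Rightarrow> ('i \<Rightarrow> 'k::zero) set \<Rightarrow> bool" where
  "determining P V \<longleftrightarrow> (\<forall>x\<in>V. (\<forall>p\<in>P. x p = 0) \<longrightarrow> x = (\<lambda>_. 0))"

lemma determining_span_insert:
  fixes s :: "'i \<Rightarrow> 'k::field"
  assumes P: "determining P (fun_space.span S)"
  shows "\<exists>p. determining (insert p P) (fun_space.span (insert s S))"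
proof (cases "determining P (fun_space.span (insert s S))")
  case True
  then show ?thesis unfolding determining_def by blast
next
  case False
  then obtain v where v: "v \<in> fun_space.span (insert s S)" "\<forall>p\<in>P. v p = 0" "v \<noteq> (\<lambda>_. 0)"
    unfolding determining_def by blast
  then obtain p where p: "v p \<noteq> 0" by blast
  obtain c where c: "v - fun_scale c s \<in> fun_space.span S"
    using v(1) unfolding fun_space.span_breakdown_eq by blast
  have "c \<noteq> 0" using c v(2,3) P unfolding determining_def by (auto simp: fun_scale_def func_zero)
  have "x = (\<lambda>_. 0)" if x: "x \<in> fun_space.span (insert s S)" "\<forall>q\<in>insert p P. x q = 0" for x
  proof -
    obtain d where d: "x - fun_scale d s \<in> fun_space.span S"
      using x(1) unfolding fun_space.span_breakdown_eq by blast
    define r where "r = (x - fun_scale d s) - fun_scale (d / c) (v - fun_scale c s)"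
    have r: "r i = x i - d / c * v i" for i
      using \<open>c \<noteq> 0\<close> by (simp add: r_def fun_scale_def algebra_simps)
    have "r \<in> fun_space.span S"
      unfolding r_def by (rule fun_space.span_diff[OF d fun_space.span_scale[OF c]])
    moreover have "\<forall>q\<in>P. r q = 0" using r x(2) v(2) by simp
    ultimately have r_eq_0: "r = (\<lambda>_. 0)" using P unfolding determining_def by blast
    then have "d / c = 0" using r[of p] x(2) p by simp
    then show ?thesis using r r_eq_0 \<open>c \<noteq> 0\<close> by (simp add: fun_eq_iff)
  qed
  then show ?thesis unfolding determining_def by blast
qed

lemma determining_span_exists:
  fixes S :: "('i \<Rightarrow> 'k::field) set"
  assumes "finite S"
  shows "\<exists>P. finite P \<and> card P \<le> card S \<and> determining P (fun_space.span S)"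
  using assms
proof induction
  case empty
  show ?case by (intro exI[of _ "{}"]) (simp add: determining_def func_zero)
next
  case (insert s S)
  then obtain P where P: "finite P" "card P \<le> card S" "determining P (fun_space.span S)"
    by blast
  obtain p where "determining (insert p P) (fun_space.span (insert s S))"
    using determining_span_insert[OF P(3)] by blast
  moreover have "card (insert p P) \<le> card (insert s S)"
    using P insert.hyps by (simp add: card_insert_if)
  ultimately show ?case using P(1) by blast
qed

definition prime_exponents :: "'a::factorial_semiring \<Rightarrow> 'a \<Rightarrow> rat" where
  "prime_exponents a p = (if prime p then of_nat (multiplicity p a) else 0)"

lemma prime_exponents_mult:
  "a \<noteq> 0 \<Longrightarrow> b \<noteq> 0 \<Longrightarrow> prime_exponents (a * b) = prime_exponents a + prime_exponents b"
  by (auto simp: prime_exponents_def fun_eq_iff prime_elem_multiplicity_mult_distrib)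

lemma prime_exponents_eq_imp_normalize_eq:
  fixes a b :: "'a::factorial_semiring"
  assumes "a \<noteq> 0" "b \<noteq> 0" "prime_exponents a = prime_exponents b"
  shows "normalize a = normalize b"
proof (rule multiplicity_eq_imp_eq[OF assms(1,2)])
  fix p :: 'a assume "prime p"
  then show "multiplicity p a = multiplicity p b"
    using fun_cong[OF assms(3), of p] by (simp add: prime_exponents_def)
qed

interpretation int_log: log_map fun_scale "prime_exponents :: int \<Rightarrow> int \<Rightarrow> rat"
  by standard (simp add: prime_exponents_mult)

lemma obtain_separating_primes:
  fixes A :: "int set"
  assumes A: "finite A" "\<And>a. a \<in> A \<Longrightarrow> 0 < a"
  obtains P where "finite P" "card P \<le> int_log.mult_dim A"
    "inj_on (\<lambda>a. restrict (prime_exponents a) P) A"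
proof -
  obtain T where T: "finite T" "card T = int_log.mult_dim A"
    "\<And>a b. a \<in> A \<Longrightarrow> b \<in> A \<Longrightarrow> prime_exponents a - prime_exponents b \<in> fun_space.span T"
    using int_log.obtain_spanning_logs[OF A(1)] by blast
  obtain P where P: "finite P" "card P \<le> card T" "determining P (fun_space.span T)"
    using determining_span_exists[OF T(1)] by blast
  have "inj_on (\<lambda>a. restrict (prime_exponents a) P) A"
  proof (rule inj_onI)
    fix a b assume ab: "a \<in> A" "b \<in> A"
      "restrict (prime_exponents a) P = restrict (prime_exponents b) P"
    then have "\<forall>p\<in>P. (prime_exponents a - prime_exponents b) p = 0"
      by (auto simp: fun_eq_iff restrict_def split: if_splits)
    then have "prime_exponents a - prime_exponents b = 0"
      using P(3) T(3)[OF ab(1,2)] unfolding determining_def func_zero by blast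
    then have "normalize a = normalize b"
      using A(2) ab(1,2) by (intro prime_exponents_eq_imp_normalize_eq) auto
    then show "a = b" using A(2) ab(1,2) by (auto simp: abs_of_pos)
  qed
  then show ?thesis using P(1,2) T(2) that by metis
qed

subsection \<open>Multiplicative energies\<close>

definition multiplicative_solutions :: "nat \<Rightarrow> 'a::comm_monoid_mult set \<Rightarrow> (nat \<Rightarrow> 'a) set" where
  "multiplicative_solutions k B =
     {b \<in> {..<2*k} \<rightarrow>\<^sub>E B. (\<Prod>i<k. b i) = (\<Prod>i=k..<2*k. b i)}"

definition mixed_energy :: "nat \<Rightarrow> (nat \<Rightarrow> 'a::comm_monoid_mult \<Rightarrow> real) \<Rightarrow> 'a set \<Rightarrow> real" where
  "mixed_energy k g B = (\<Sum>b\<in>multiplicative_solutions k B. \<Prod>i<2*k. g i (b i))"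

lemma finite_multiplicative_solutions: "finite B \<Longrightarrow> finite (multiplicative_solutions k B)"
  unfolding multiplicative_solutions_def
  by (rule finite_subset[OF _ finite_PiE[of "{..<2*k}" "\<lambda>_. B"]]) auto

lemma multiplicative_solutions_mem:
  "b \<in> multiplicative_solutions k B \<Longrightarrow> i < 2 * k \<Longrightarrow> b i \<in> B"
  unfolding multiplicative_solutions_def by (auto dest: PiE_mem)

lemma weighted_energy_eq_mixed_energy: "weighted_energy k w B = mixed_energy k (\<lambda>_. w) B"
  unfolding weighted_energy_def mixed_energy_def multiplicative_solutions_def ..

lemma weighted_energy_scale:
  "weighted_energy k (\<lambda>b. c * w b) B = c ^ (2 * k) * weighted_energy k w B"
  unfolding weighted_energy_def sum_distrib_left by (intro sum.cong) (auto simp: prod.distrib)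

lemma weighted_energy_restrict:
  assumes "finite B"
  shows "weighted_energy k (\<lambda>b. if P b then w b else 0) B = weighted_energy k w {b \<in> B. P b}"
  unfolding weighted_energy_eq_mixed_energy mixed_energy_def
proof (rule sum.mono_neutral_cong_right[OF finite_multiplicative_solutions[OF assms]])
  let ?Sol = "multiplicative_solutions k B" and ?Sol' = "multiplicative_solutions k {b \<in> B. P b}"
  show "?Sol' \<subseteq> ?Sol"
    unfolding multiplicative_solutions_def by (auto simp: PiE_iff)
  show "\<forall>b\<in>?Sol - ?Sol'. (\<Prod>i<2*k. if P (b i) then w (b i) else 0) = 0"
  proof
    fix b assume "b \<in> ?Sol - ?Sol'"
    then obtain i where "i < 2 * k" "\<not> P (b i)"
      unfolding multiplicative_solutions_def by (auto simp: PiE_iff)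
    then show "(\<Prod>i<2*k. if P (b i) then w (b i) else 0) = 0" by (intro prod_zero) auto
  qed
  show "(\<Prod>i<2*k. if P (b i) then w (b i) else 0) = (\<Prod>i<2*k. w (b i))" if "b \<in> ?Sol'" for b
    using multiplicative_solutions_mem[OF that] by (intro prod.cong) auto
qed

lemma weighted_energy_le_card:
  fixes B :: "'a::comm_monoid_mult set"
  assumes "finite B" "\<And>b. b \<in> B \<Longrightarrow> 0 \<le> w b"
  shows "weighted_energy k w B \<le> (real (card B) * (\<Sum>b\<in>B. (w b)\<^sup>2)) ^ k"
proof -
  have "weighted_energy k w B \<le> (\<Sum>b\<in>{..<2*k} \<rightarrow>\<^sub>E B. \<Prod>i<2*k. w (b i))"
    unfolding weighted_energy_def using assms
    by (intro sum_mono2 finite_PiE prod_nonneg) (auto dest: PiE_mem)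
  also have "\<dots> = (\<Prod>i<2*k. \<Sum>b\<in>B. w b)" using assms(1) by (subst prod_sum_PiE) auto
  also have "\<dots> = ((\<Sum>b\<in>B. w b)\<^sup>2) ^ k" by (simp add: power_mult)
  also have "\<dots> \<le> (real (card B) * (\<Sum>b\<in>B. (w b)\<^sup>2)) ^ k"
    using sum_squared_le_sum_of_squares[of w B] by (intro power_mono) (auto simp: mult.commute)
  finally show ?thesis .
qed

lemma iterated_product_set_eq_image:
  "iterated_product_set B k = (\<lambda>b. \<Prod>i<k. b i) ` ({..<k} \<rightarrow>\<^sub>E B)"
proof (intro equalityI subsetI)
  fix x assume "x \<in> iterated_product_set B k"
  then obtain b where b: "x = (\<Prod>i<k. b i)" "\<forall>i<k. b i \<in> B"
    unfolding iterated_product_set_def by blast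
  then have "x = (\<Prod>i<k. restrict b {..<k} i)" "restrict b {..<k} \<in> {..<k} \<rightarrow>\<^sub>E B" by auto
  then show "x \<in> (\<lambda>b. \<Prod>i<k. b i) ` ({..<k} \<rightarrow>\<^sub>E B)" by blast
qed (auto simp: iterated_product_set_def PiE_iff)

lemma finite_iterated_product_set: "finite B \<Longrightarrow> finite (iterated_product_set B k)"
  unfolding iterated_product_set_eq_image by (intro finite_imageI finite_PiE) auto

lemma prod_upper_half:
  fixes f :: "nat \<Rightarrow> 'a::comm_monoid_mult"
  shows "(\<Prod>i=k..<2*k. f i) = (\<Prod>i<k. f (i + k))"
  using prod.shift_bounds_nat_ivl[of f 0 k k] by (simp add: mult_2 lessThan_atLeast0)

lemma prod_lower_upper_half:
  fixes f :: "nat \<Rightarrow> 'a::comm_monoid_mult"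
  shows "(\<Prod>i<2*k. f i) = (\<Prod>i<k. f i) * (\<Prod>i=k..<2*k. f i)"
  using prod.atLeastLessThan_concat[of 0 k "2*k" f] by (simp add: lessThan_atLeast0)

lemma weighted_energy_eq_sum_pairs:
  "weighted_energy k w B =
     (\<Sum>(x, y) \<in> {(x, y). x \<in> {..<k} \<rightarrow>\<^sub>E B \<and> y \<in> {..<k} \<rightarrow>\<^sub>E B \<and> (\<Prod>i<k. x i) = (\<Prod>i<k. y i)}.
        (\<Prod>i<k. w (x i)) * (\<Prod>i<k. w (y i)))"
proof -
  let ?join = "\<lambda>(x, y). \<lambda>i\<in>{..<2*k}. if i < k then x i else y (i - k) :: 'a"
  let ?split = "\<lambda>b :: nat \<Rightarrow> 'a. (restrict b {..<k}, \<lambda>i\<in>{..<k}. b (i + k))"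
  show ?thesis
    unfolding weighted_energy_eq_mixed_energy mixed_energy_def
  proof (rule sum.reindex_bij_witness[where i = ?join and j = ?split])
    fix b assume "b \<in> multiplicative_solutions k B"
    then show "?join (?split b) = b"
      and "?split b \<in> {(x, y). x \<in> {..<k} \<rightarrow>\<^sub>E B \<and> y \<in> {..<k} \<rightarrow>\<^sub>E B \<and> (\<Prod>i<k. x i) = (\<Prod>i<k. y i)}"
      by (auto simp: multiplicative_solutions_def fun_eq_iff PiE_iff extensional_def prod_upper_half)
    show "(case ?split b of (x, y) \<Rightarrow> (\<Prod>i<k. w (x i)) * (\<Prod>i<k. w (y i))) = (\<Prod>i<2*k. w (b i))"
      by (simp add: prod_lower_upper_half prod_upper_half)
  next
    fix xy assume "xy \<in> {(x, y). x \<in> {..<k} \<rightarrow>\<^sub>E B \<and> y \<in> {..<k} \<rightarrow>\<^sub>E B \<and> (\<Prod>i<k. x i) = (\<Prod>i<k. y i)}"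
    then show "?split (?join xy) = xy" and "?join xy \<in> multiplicative_solutions k B"
      by (auto simp: multiplicative_solutions_def fun_eq_iff PiE_iff extensional_def prod_upper_half)
  qed
qed

lemma weighted_energy_eq_sum_squares:
  assumes "finite B"
  shows "weighted_energy k w B =
    (\<Sum>z\<in>iterated_product_set B k.
       (\<Sum>x | x \<in> {..<k} \<rightarrow>\<^sub>E B \<and> (\<Prod>i<k. x i) = z. \<Prod>i<k. w (x i))\<^sup>2)"
proof -
  define X where "X = {..<k} \<rightarrow>\<^sub>E B"
  define \<pi> where "\<pi> x = (\<Prod>i<k. x i)" for x :: "nat \<Rightarrow> 'a"
  define v where "v x = (\<Prod>i<k. w (x i))" for x
  have fin: "finite X" using assms unfolding X_def by (intro finite_PiE) auto
  have "{(x, y). x \<in> X \<and> y \<in> X \<and> \<pi> x = \<pi> y} = (SIGMA x:X. {y \<in> X. \<pi> y = \<pi> x})" by auto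
  then have "weighted_energy k w B = (\<Sum>x\<in>X. \<Sum>y | y \<in> X \<and> \<pi> y = \<pi> x. v x * v y)"
    unfolding weighted_energy_eq_sum_pairs X_def[symmetric] \<pi>_def[symmetric] v_def[symmetric]
    using fin by (simp add: sum.Sigma)
  also have "\<dots> = (\<Sum>z\<in>\<pi> ` X. \<Sum>x | x \<in> X \<and> \<pi> x = z. \<Sum>y | y \<in> X \<and> \<pi> y = \<pi> x. v x * v y)"
    using fin by (rule sum.image_gen)
  also have "\<dots> = (\<Sum>z\<in>\<pi> ` X. (\<Sum>x | x \<in> X \<and> \<pi> x = z. v x)\<^sup>2)"
    unfolding power2_eq_square sum_product by (intro sum.cong) auto
  finally show ?thesis
    unfolding iterated_product_set_eq_image X_def \<pi>_def v_def .
qed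

subsection \<open>The energy constant\<close>

lemma weighted_energy_le_Lambda_const_power:
  assumes "finite B" "B \<noteq> {}" "1 \<le> k" "w \<in> unit_weights B"
  shows "weighted_energy k w B \<le> Lambda_const k B ^ k"
proof -
  have nonneg: "0 \<le> weighted_energy k w B"
    using assms(4) by (intro weighted_energy_nonneg) (simp add: unit_weights_def)
  have "weighted_energy k w B powr (1 / real k) \<le> Lambda_const k B"
    using Lambda_const_is_max[OF assms(1,2)] assms(4) by metis
  then have "(weighted_energy k w B powr (1 / real k)) ^ k \<le> Lambda_const k B ^ k"
    by (intro power_mono) auto
  also have "(weighted_energy k w B powr (1 / real k)) ^ k = weighted_energy k w B"
    using nonneg assms(3)
    by (cases "weighted_energy k w B = 0") (auto simp: powr_powr simp flip: powr_realpow)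
  finally show ?thesis .
qed

lemma Lambda_const_nonneg:
  assumes "finite B" "B \<noteq> {}"
  shows "0 \<le> Lambda_const k B"
  using Lambda_const_is_max[OF assms, of k] by auto

lemma Lambda_const_leI:
  assumes "finite B" "B \<noteq> {}" "1 \<le> k" "0 \<le> M"
    and le: "\<And>w. w \<in> unit_weights B \<Longrightarrow> weighted_energy k w B \<le> M ^ k"
  shows "Lambda_const k B \<le> M"
proof -
  obtain w where w: "w \<in> unit_weights B"
    "Lambda_const k B = weighted_energy k w B powr (1 / real k)"
    using Lambda_const_is_max[OF assms(1,2)] by blast
  have "weighted_energy k w B powr (1 / real k) \<le> (M ^ k) powr (1 / real k)"
    using w(1) le by (intro powr_mono2 weighted_energy_nonneg) (auto simp: unit_weights_def)
  also have "\<dots> = M"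
    using assms(3,4) by (cases "M = 0") (auto simp: powr_realpow[symmetric] powr_powr)
  finally show ?thesis using w(2) by simp
qed

lemma Lambda_const_le_card:
  fixes B :: "'a::comm_monoid_mult set"
  assumes "finite B" "B \<noteq> {}" "1 \<le> k"
  shows "Lambda_const k B \<le> real (card B)"
proof (rule Lambda_const_leI[OF assms])
  fix w assume "w \<in> unit_weights B"
  then show "weighted_energy k w B \<le> real (card B) ^ k"
    using weighted_energy_le_card[OF assms(1), of w k] by (simp add: unit_weights_def)
qed simp

lemma weighted_energy_le_Lambda_const:
  fixes B :: "'a::comm_monoid_mult set"
  assumes "finite B" "1 \<le> k" and w: "\<And>b. b \<in> B \<Longrightarrow> 0 \<le> w b"
  shows "weighted_energy k w B \<le> (Lambda_const k B * (\<Sum>b\<in>B. (w b)\<^sup>2)) ^ k"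
proof (cases "(\<Sum>b\<in>B. (w b)\<^sup>2) = 0")
  case True
  then show ?thesis using weighted_energy_le_card[of B w k] assms by simp
next
  case False
  define c where "c = sqrt (\<Sum>b\<in>B. (w b)\<^sup>2)"
  have c: "0 < c" "c\<^sup>2 = (\<Sum>b\<in>B. (w b)\<^sup>2)"
    using False by (auto simp: c_def sum_nonneg less_le)
  have "B \<noteq> {}" using False by auto
  moreover have "(\<Sum>b\<in>B. (w b / c)\<^sup>2) = 1"
    using c False by (simp add: power_divide flip: sum_divide_distrib)
  then have "(\<lambda>b. w b / c) \<in> unit_weights B"
    using w c(1) by (simp add: unit_weights_def)
  ultimately have "weighted_energy k (\<lambda>b. w b / c) B \<le> Lambda_const k B ^ k"
    by (intro weighted_energy_le_Lambda_const_power assms(1,2))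
  then have "c ^ (2 * k) * weighted_energy k (\<lambda>b. w b / c) B \<le> (c\<^sup>2) ^ k * Lambda_const k B ^ k"
    unfolding power_mult by (intro mult_left_mono) auto
  then show ?thesis
    using c(1) unfolding weighted_energy_scale[symmetric] c(2)
    by (simp add: power_mult_distrib mult.commute)
qed

theorem card_iterated_product_set_ge:
  fixes B :: "'a::comm_monoid_mult set"
  assumes B: "finite B" "B \<noteq> {}" and k: "1 \<le> k"
  shows "real (card B) ^ k \<le> real (card (iterated_product_set B k)) * Lambda_const k B ^ k"
proof -
  define X where "X = {..<k} \<rightarrow>\<^sub>E B"
  define r where "r z = real (card {x \<in> X. (\<Prod>i<k. x i) = z})" for z
  let ?Z = "iterated_product_set B k"
  have "finite X" using B(1) unfolding X_def by (intro finite_PiE) auto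
  then have "real (card X) = (\<Sum>z\<in>?Z. r z)"
    using sum.image_gen[of X "\<lambda>_. 1::real" "\<lambda>x. \<Prod>i<k. x i"]
    by (simp add: r_def iterated_product_set_eq_image X_def)
  then have "(real (card B) ^ k)\<^sup>2 = (\<Sum>z\<in>?Z. r z)\<^sup>2"
    unfolding X_def by (simp add: card_PiE)
  also have "\<dots> \<le> (\<Sum>z\<in>?Z. (r z)\<^sup>2) * real (card ?Z)"
    by (rule sum_squared_le_sum_of_squares)
  also have "\<dots> = real (card ?Z) * weighted_energy k (\<lambda>_. 1) B"
    by (simp add: weighted_energy_eq_sum_squares[OF B(1)] r_def X_def)
  also have "\<dots> \<le> real (card ?Z) * (Lambda_const k B * real (card B)) ^ k"
    using weighted_energy_le_Lambda_const[OF B(1) k, of "\<lambda>_. 1"] by (intro mult_left_mono) auto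
  finally have "real (card B) ^ k * real (card B) ^ k
      \<le> (real (card ?Z) * Lambda_const k B ^ k) * real (card B) ^ k"
    by (simp add: power2_eq_square power_mult_distrib mult_ac)
  moreover have "0 < real (card B) ^ k" using B by (simp add: card_gt_0_iff)
  ultimately show ?thesis by (simp only: mult_le_cancel_right_pos)
qed

subsection \<open>Correlations in a real group ring\<close>

alias lookup = Poly_Mapping.lookup
alias keys = Poly_Mapping.keys
alias single = Poly_Mapping.single

lemma lookup_mult_eq_sum:
  fixes p q :: "'g::ab_group_add \<Rightarrow>\<^sub>0 'r::semiring_0"
  assumes "finite I" "keys p \<subseteq> I"
  shows "lookup (p * q) x = (\<Sum>y\<in>I. lookup p y * lookup q (x - y))"
proof -
  have "x = y + z \<longleftrightarrow> z = x - y" for y z by (auto simp: algebra_simps)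
  then have "lookup (p * q) x = Sum_any (\<lambda>y. lookup p y * lookup q (x - y))"
    by (simp add: lookup_mult)
  also have "\<dots> = (\<Sum>y\<in>I. lookup p y * lookup q (x - y))"
    using assms
    by (intro Sum_any.expand_superset) (auto simp: in_keys_iff subset_iff dest: mult_not_zero)
  finally show ?thesis .
qed

lemma prod_single:
  fixes c :: "'i \<Rightarrow> 'r::comm_semiring_1" and x :: "'i \<Rightarrow> 'g::comm_monoid_add"
  shows "(\<Prod>i\<in>I. single (x i) (c i)) = single (\<Sum>i\<in>I. x i) (\<Prod>i\<in>I. c i)"
  by (induction I rule: infinite_finite_induct) (simp_all add: mult_single)

definition reflection :: "('g::ab_group_add \<Rightarrow>\<^sub>0 real) \<Rightarrow> 'g \<Rightarrow>\<^sub>0 real" where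
  "reflection p = Poly_Mapping.map_key uminus p"

text \<open>
  On the dual group \<open>gram p\<close> becomes \<open>|p|\<^sup>2\<close> and the coefficient at \<open>0\<close> the integral, so the
  inequalities of this section are those between \<open>L\<^sup>p\<close> norms, obtained here without characters.
\<close>
definition gram :: "('g::ab_group_add \<Rightarrow>\<^sub>0 real) \<Rightarrow> 'g \<Rightarrow>\<^sub>0 real" where
  "gram p = p * reflection p"

lemma lookup_reflection [simp]: "lookup (reflection p) x = lookup p (- x)"
  by (simp add: reflection_def map_key.rep_eq inj_on_def)

lemma keys_reflection: "keys (reflection p) = uminus ` keys p"
  by (force simp: in_keys_iff image_iff)

lemma reflection_reflection [simp]: "reflection (reflection p) = p"
  by (rule poly_mapping_eqI) simp

lemma reflection_single [simp]: "reflection (single x c) = single (- x) c"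
  by (rule poly_mapping_eqI) (auto simp: lookup_single when_def)

lemma reflection_sum: "reflection (\<Sum>i\<in>I. p i) = (\<Sum>i\<in>I. reflection (p i))"
  by (rule poly_mapping_eqI) (simp add: lookup_sum)

lemma reflection_mult: "reflection (p * q) = reflection p * reflection q"
proof (rule poly_mapping_eqI)
  fix x
  have "lookup (reflection p * reflection q) x =
      (\<Sum>y\<in>uminus ` keys p. lookup p (- y) * lookup q (- (x - y)))"
    by (subst lookup_mult_eq_sum[of "uminus ` keys p"]) (simp_all add: keys_reflection)
  also have "\<dots> = (\<Sum>y\<in>keys p. lookup p y * lookup q (- x - y))"
    by (subst sum.reindex) (simp_all add: inj_on_def minus_diff_commute)
  finally show "lookup (reflection (p * q)) x = lookup (reflection p * reflection q) x"
    by (simp add: lookup_mult_eq_sum[OF finite_keys order.refl])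
qed

lemma gram_mult: "gram (p * q) = gram p * gram q"
  by (simp add: gram_def reflection_mult mult_ac)

lemma gram_one [simp]: "gram 1 = 1"
  using reflection_single[of 0 1] by (simp add: gram_def)

lemma gram_power: "gram (p ^ n) = gram p ^ n"
  by (induction n) (simp_all add: gram_mult)

lemma gram_prod: "gram (\<Prod>i\<in>I. p i) = (\<Prod>i\<in>I. gram (p i))"
  by (induction I rule: infinite_finite_induct) (simp_all add: gram_mult)

lemma gram_reflection [simp]: "gram (reflection p) = gram p"
  by (simp add: gram_def mult.commute)

lemma reflection_gram [simp]: "reflection (gram p) = gram p"
  by (simp add: gram_def reflection_mult mult.commute)

lemma gram_gram: "gram (gram p) = gram p ^ 2"
  by (simp add: gram_def[of "gram p"] power2_eq_square)

lemma lookup_gram_0: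
  assumes "finite I" "keys p \<subseteq> I"
  shows "lookup (gram p) 0 = (\<Sum>x\<in>I. (lookup p x)\<^sup>2)"
  unfolding gram_def using assms by (simp add: lookup_mult_eq_sum power2_eq_square)

lemma lookup_gram_0_nonneg: "0 \<le> lookup (gram p) 0"
  by (simp add: lookup_gram_0[OF finite_keys order.refl] sum_nonneg)

lemma lookup_mult_0_Cauchy_Schwarz:
  "(lookup (p * q) 0)\<^sup>2 \<le> lookup (gram p) 0 * lookup (gram q) 0"
proof -
  define I where "I = keys p \<union> keys (reflection q)"
  have I: "finite I" "keys p \<subseteq> I" "keys (reflection q) \<subseteq> I"
    by (simp_all add: I_def)
  have "(lookup (p * q) 0)\<^sup>2 = (\<Sum>x\<in>I. lookup p x * lookup (reflection q) x)\<^sup>2"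
    using lookup_mult_eq_sum[OF I(1,2), of q 0] by simp
  also have "\<dots> \<le> (\<Sum>x\<in>I. (lookup p x)\<^sup>2) * (\<Sum>x\<in>I. (lookup (reflection q) x)\<^sup>2)"
    by (rule Cauchy_Schwarz_ineq_sum)
  also have "\<dots> = lookup (gram p) 0 * lookup (gram (reflection q)) 0"
    using I by (simp only: lookup_gram_0)
  finally show ?thesis by simp
qed

lemma lookup_gram_log_convex:
  "(lookup (gram p * gram q * gram r) 0)\<^sup>2 \<le>
     lookup (gram p ^ 2 * gram r) 0 * lookup (gram q ^ 2 * gram r) 0"
proof -
  have "gram p * gram q * gram r = (gram p * r) * (gram q * reflection r)"
    by (simp add: gram_def[of r] mult_ac)
  then show ?thesis
    using lookup_mult_0_Cauchy_Schwarz[of "gram p * r" "gram q * reflection r"]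
    by (simp add: gram_mult gram_gram)
qed

lemma log_convex_ratio_le:
  fixes a :: "nat \<Rightarrow> real"
  assumes nonneg: "\<And>j. j \<le> n \<Longrightarrow> 0 \<le> a j"
    and log_convex: "\<And>j. j + 2 \<le> n \<Longrightarrow> (a (j + 1))\<^sup>2 \<le> a j * a (j + 2)"
    and "j + 1 \<le> n"
  shows "a 1 * a j \<le> a 0 * a (j + 1)"
  using assms(3)
proof (induction j)
  case (Suc j)
  show ?case
  proof (cases "a j = 0")
    case True
    then have "a (j + 1) = 0" using log_convex[of j] Suc.prems by simp
    then show ?thesis using nonneg[of 0] nonneg[of "Suc j + 1"] Suc.prems by simp
  next
    case False
    then have "0 < a j" using nonneg[of j] Suc.prems by simp
    have "a j * (a 1 * a (j + 1)) \<le> (a 0 * a (j + 1)) * a (j + 1)"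
      using mult_right_mono[OF Suc.IH nonneg[of "j + 1"]] Suc.prems by (simp add: mult_ac)
    also have "\<dots> \<le> a 0 * (a j * a (j + 2))"
      using mult_left_mono[OF log_convex[of j] nonneg[of 0]] Suc.prems
      by (simp add: power2_eq_square mult_ac)
    finally show ?thesis using \<open>0 < a j\<close> by (simp add: mult_ac)
  qed
qed simp

lemma log_convex_power_le:
  fixes a :: "nat \<Rightarrow> real"
  assumes nonneg: "\<And>j. j \<le> n \<Longrightarrow> 0 \<le> a j"
    and log_convex: "\<And>j. j + 2 \<le> n \<Longrightarrow> (a (j + 1))\<^sup>2 \<le> a j * a (j + 2)"
    and "1 \<le> n"
  shows "a 1 ^ n \<le> a n * a 0 ^ (n - 1)"
proof -
  have "a 1 ^ (j + 1) \<le> a (j + 1) * a 0 ^ j" if "j + 1 \<le> n" for j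
    using that
  proof (induction j)
    case (Suc j)
    have "a 1 ^ (Suc j + 1) \<le> a 1 * (a (j + 1) * a 0 ^ j)"
      using mult_left_mono[OF Suc.IH nonneg[of 1]] Suc.prems by simp
    also have "a 1 * a (j + 1) \<le> a 0 * a (j + 2)"
      using log_convex_ratio_le[of n a "j + 1"] nonneg log_convex Suc.prems by simp
    then have "a 1 * (a (j + 1) * a 0 ^ j) \<le> (a 0 * a (j + 2)) * a 0 ^ j"
      using mult_right_mono[of _ _ "a 0 ^ j"] nonneg[of 0] by (simp add: mult.assoc[symmetric])
    finally show ?case by (simp add: mult_ac)
  qed simp
  from this[of "n - 1"] show ?thesis using \<open>1 \<le> n\<close> by simp
qed

lemma lookup_gram_Hoelder:
  assumes "1 \<le> k"
  shows "lookup (gram p * gram q ^ (k - 1)) 0 ^ k \<le>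
    lookup (gram p ^ k) 0 * lookup (gram q ^ k) 0 ^ (k - 1)"
proof -
  define a where "a j = lookup (gram p ^ j * gram q ^ (k - j)) 0" for j
  have "a 1 ^ k \<le> a k * a 0 ^ (k - 1)"
  proof (rule log_convex_power_le[OF _ _ assms])
    show "0 \<le> a j" for j
      unfolding a_def by (simp flip: gram_power gram_mult add: lookup_gram_0_nonneg)
    show "(a (j + 1))\<^sup>2 \<le> a j * a (j + 2)" if "j + 2 \<le> k" for j
    proof -
      define n where "n = k - (j + 2)"
      then have k: "k = n + j + 2" using that by simp
      show ?thesis
        using lookup_gram_log_convex[of p q "p ^ j * q ^ n"]
        unfolding a_def k by (simp add: gram_mult gram_power power2_eq_square mult_ac)
    qed
  qed
  then show ?thesis by (simp add: a_def)
qed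

lemma abs_lookup_prod_le_gram:
  assumes X: "finite X" "card X = 2 * k" and D: "D \<subseteq> X" "card D = 2"
    and gram: "\<And>i. i \<in> X \<Longrightarrow> gram (h i) = (if i \<in> D then gram p else gram q)"
  shows "\<bar>lookup (\<Prod>i\<in>X. h i) 0\<bar> \<le> lookup (gram p * gram q ^ (k - 1)) 0" (is "_ \<le> ?r")
proof -
  obtain s t where D_eq: "D = {s, t}" and "s \<noteq> t" using D(2) by (auto simp: card_2_iff)
  have "card (X - D) = 2 * (k - 1)" using X D by (simp add: card_Diff_subset finite_subset)
  then obtain U where U: "U \<subseteq> X - D" "card U = k - 1" "finite U"
    using obtain_subset_with_card_n[of "k - 1" "X - D"] by auto
  define V where "V = X - D - U"
  have V: "V \<subseteq> X - D" "card V = k - 1" "finite V"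
    using U X(1) \<open>card (X - D) = 2 * (k - 1)\<close> by (simp_all add: V_def card_Diff_subset)
  have half: "gram (\<Prod>i\<in>insert r W. h i) = gram p * gram q ^ (k - 1)"
    if "r \<in> D" "W \<subseteq> X - D" "card W = k - 1" "finite W" for r W
  proof -
    have "(\<Prod>i\<in>W. gram (h i)) = (\<Prod>i\<in>W. gram q)"
      using that(2) by (intro prod.cong) (auto simp: gram)
    moreover have "r \<notin> W" "r \<in> X" using that(1,2) D(1) by blast+
    ultimately show ?thesis using that by (simp add: gram_prod gram_mult gram)
  qed
  have "X = insert s U \<union> insert t V" using D(1) U(1) by (auto simp: V_def D_eq)
  then have "(\<Prod>i\<in>X. h i) = (\<Prod>i\<in>insert s U. h i) * (\<Prod>i\<in>insert t V. h i)"
    using \<open>s \<noteq> t\<close> U V(3) by (simp only:) (intro prod.union_disjoint; auto simp: V_def D_eq)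
  then have "(lookup (\<Prod>i\<in>X. h i) 0)\<^sup>2 \<le> ?r\<^sup>2"
    using lookup_mult_0_Cauchy_Schwarz[of "\<Prod>i\<in>insert s U. h i" "\<Prod>i\<in>insert t V. h i"]
      half[OF _ U, of s] half[OF _ V, of t] by (simp add: power2_eq_square D_eq)
  moreover have "0 \<le> ?r"
    by (simp flip: gram_power gram_mult add: lookup_gram_0_nonneg)
  ultimately show ?thesis by (simp add: abs_le_square_iff[symmetric])
qed

subsection \<open>Hoelder's inequality for mixed energies\<close>

locale log_embedding =
  fixes S :: "'a::comm_monoid_mult set" and \<phi> :: "'a \<Rightarrow> 'g::ab_group_add"
  assumes one_closed: "1 \<in> S"
    and mult_closed: "a \<in> S \<Longrightarrow> b \<in> S \<Longrightarrow> a * b \<in> S"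
    and log_mult: "a \<in> S \<Longrightarrow> b \<in> S \<Longrightarrow> \<phi> (a * b) = \<phi> a + \<phi> b"
    and log_inj: "inj_on \<phi> S"
begin

definition transform :: "('a \<Rightarrow> real) \<Rightarrow> 'a set \<Rightarrow> 'g \<Rightarrow>\<^sub>0 real" where
  "transform w B = (\<Sum>b\<in>B. single (\<phi> b) (w b))"

lemma prod_closed: "(\<And>i. i \<in> I \<Longrightarrow> b i \<in> S) \<Longrightarrow> (\<Prod>i\<in>I. b i) \<in> S"
  by (induction I rule: infinite_finite_induct) (auto intro: one_closed mult_closed)

lemma log_one: "\<phi> 1 = 0"
  using log_mult[OF one_closed one_closed] by simp

lemma log_prod: "(\<And>i. i \<in> I \<Longrightarrow> b i \<in> S) \<Longrightarrow> \<phi> (\<Prod>i\<in>I. b i) = (\<Sum>i\<in>I. \<phi> (b i))"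
  by (induction I rule: infinite_finite_induct) (simp_all add: log_one log_mult prod_closed)

lemma prod_eq_iff_sum_log_eq:
  assumes "\<And>i. i \<in> I \<union> J \<Longrightarrow> b i \<in> S"
  shows "(\<Prod>i\<in>I. b i) = (\<Prod>i\<in>J. b i) \<longleftrightarrow> (\<Sum>i\<in>I. \<phi> (b i)) = (\<Sum>i\<in>J. \<phi> (b i))"
  using inj_on_eq_iff[OF log_inj prod_closed prod_closed, of I b J b] assms
  by (simp add: log_prod)

lemma mixed_energy_eq_lookup:
  assumes "finite B" "B \<subseteq> S"
  shows "mixed_energy k g B =
    lookup (\<Prod>i<2*k. if i < k then transform (g i) B else reflection (transform (g i) B)) 0"
proof -
  define \<epsilon> :: "nat \<Rightarrow> 'g \<Rightarrow> 'g" where "\<epsilon> i x = (if i < k then x else - x)" for i x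
  have sum_zero: "(\<Sum>i<2*k. \<epsilon> i (\<phi> (b i))) = 0 \<longleftrightarrow> (\<Prod>i<k. b i) = (\<Prod>i=k..<2*k. b i)"
    if "b \<in> {..<2*k} \<rightarrow>\<^sub>E B" for b
  proof -
    have "(\<Sum>i<2*k. \<epsilon> i (\<phi> (b i))) = (\<Sum>i<k. \<phi> (b i)) - (\<Sum>i=k..<2*k. \<phi> (b i))"
      using sum.atLeastLessThan_concat[of 0 k "2 * k" "\<lambda>i. \<epsilon> i (\<phi> (b i))"]
      by (simp add: \<epsilon>_def lessThan_atLeast0 sum_negf)
    moreover have "\<And>i. i \<in> {..<k} \<union> {k..<2*k} \<Longrightarrow> b i \<in> S"
      using that assms(2) by (auto dest: PiE_mem)
    ultimately show ?thesis
      using prod_eq_iff_sum_log_eq[of "{..<k}" "{k..<2*k}" b] by simp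
  qed
  have "(if i < k then transform (g i) B else reflection (transform (g i) B)) =
      (\<Sum>b\<in>B. single (\<epsilon> i (\<phi> b)) (g i b))" for i
    by (simp add: transform_def \<epsilon>_def reflection_sum)
  then have "lookup (\<Prod>i<2*k.
        if i < k then transform (g i) B else reflection (transform (g i) B)) 0 =
      (\<Sum>b\<in>{..<2*k} \<rightarrow>\<^sub>E B. lookup (\<Prod>i<2*k. single (\<epsilon> i (\<phi> (b i))) (g i (b i))) 0)"
    using assms(1) by (simp add: prod_sum_PiE lookup_sum)
  also have "\<dots> = (\<Sum>b\<in>{..<2*k} \<rightarrow>\<^sub>E B.
      if (\<Prod>i<k. b i) = (\<Prod>i=k..<2*k. b i) then \<Prod>i<2*k. g i (b i) else 0)"
    by (intro sum.cong) (simp_all add: prod_single lookup_single sum_zero when_def)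
  also have "\<dots> = mixed_energy k g B"
    unfolding mixed_energy_def multiplicative_solutions_def using assms(1)
    by (intro sum.inter_filter[symmetric] finite_PiE) auto
  finally show ?thesis ..
qed

lemma weighted_energy_eq_lookup_gram:
  assumes "finite B" "B \<subseteq> S"
  shows "weighted_energy k w B = lookup (gram (transform w B) ^ k) 0"
proof -
  have "(\<Prod>i<2*k. if i < k then p else reflection p) = gram p ^ k" for p :: "'g \<Rightarrow>\<^sub>0 real"
    by (simp add: prod_lower_upper_half gram_def power_mult_distrib)
  then show ?thesis
    using mixed_energy_eq_lookup[OF assms] by (simp add: weighted_energy_eq_mixed_energy)
qed

lemma mixed_energy_Hoelder:
  assumes B: "finite B" "B \<subseteq> S" and k: "1 \<le> k" and D: "D \<subseteq> {..<2*k}" "card D = 2"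
  shows "\<bar>mixed_energy k (\<lambda>i. if i \<in> D then v else w) B\<bar> ^ k \<le>
    weighted_energy k v B * weighted_energy k w B ^ (k - 1)"
proof -
  define p q where "p = transform v B" and "q = transform w B"
  define h where "h i = (if i < k then transform (if i \<in> D then v else w) B
      else reflection (transform (if i \<in> D then v else w) B))" for i
  have "\<bar>mixed_energy k (\<lambda>i. if i \<in> D then v else w) B\<bar> = \<bar>lookup (\<Prod>i<2*k. h i) 0\<bar>"
    unfolding mixed_energy_eq_lookup[OF B] h_def ..
  also have "\<dots> \<le> lookup (gram p * gram q ^ (k - 1)) 0"
    by (rule abs_lookup_prod_le_gram[OF _ _ D]) (simp_all add: h_def p_def q_def)
  finally have "\<bar>mixed_energy k (\<lambda>i. if i \<in> D then v else w) B\<bar> ^ k \<le>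
      lookup (gram p * gram q ^ (k - 1)) 0 ^ k"
    by (intro power_mono) auto
  also have "\<dots> \<le> lookup (gram p ^ k) 0 * lookup (gram q ^ k) 0 ^ (k - 1)"
    using k by (rule lookup_gram_Hoelder)
  finally show ?thesis
    unfolding p_def q_def weighted_energy_eq_lookup_gram[OF B] .
qed

end

subsection \<open>Energy constants of coloured sets\<close>

definition class_weight :: "('a \<Rightarrow> 'c) \<Rightarrow> 'c \<Rightarrow> ('a \<Rightarrow> real) \<Rightarrow> 'a \<Rightarrow> real" where
  "class_weight c j w = (\<lambda>b. if c b = j then w b else 0)"

lemma weighted_energy_le_sum_mixed_energy:
  assumes B: "finite B" and w: "\<And>b. b \<in> B \<Longrightarrow> 0 \<le> w b"
    and repeated: "\<And>b. b \<in> multiplicative_solutions k B \<Longrightarrow> \<not> inj_on (\<lambda>i. c (b i)) {..<2*k}"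
  shows "weighted_energy k w B \<le> (\<Sum>D | D \<subseteq> {..<2*k} \<and> card D = 2. \<Sum>j\<in>c ` B.
    mixed_energy k (\<lambda>i. if i \<in> D then class_weight c j w else w) B)"
proof -
  define pairs where "pairs = {D. D \<subseteq> {..<2*k} \<and> card D = 2}"
  have "finite pairs" unfolding pairs_def by simp
  define f where "f b D j = (\<Prod>i<2*k. (if i \<in> D then class_weight c j w else w) (b i))" for b D j
  have "(\<Prod>i<2*k. w (b i)) \<le> (\<Sum>(D, j)\<in>pairs \<times> c ` B. f b D j)"
    if b: "b \<in> multiplicative_solutions k B" for b
  proof -
    obtain s t where st: "s < 2 * k" "t < 2 * k" "s \<noteq> t" "c (b s) = c (b t)"
      using repeated[OF b] unfolding inj_on_def by blast
    have "(\<Prod>i<2*k. w (b i)) = (case ({s, t}, c (b s)) of (D, j) \<Rightarrow> f b D j)"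
      using st(4) by (auto simp: f_def class_weight_def intro!: prod.cong)
    also have "\<dots> \<le> (\<Sum>(D, j)\<in>pairs \<times> c ` B. f b D j)"
    proof (rule member_le_sum)
      show "({s, t}, c (b s)) \<in> pairs \<times> c ` B"
        using st imageI[OF multiplicative_solutions_mem[OF b st(1)], of c] by (auto simp: pairs_def)
      show "0 \<le> (case Dj of (D, j) \<Rightarrow> f b D j)" for Dj
        using w multiplicative_solutions_mem[OF b]
        by (auto simp: f_def class_weight_def split: prod.split intro!: prod_nonneg)
    qed (use B \<open>finite pairs\<close> in simp)
    finally show ?thesis .
  qed
  then have "weighted_energy k w B \<le>
      (\<Sum>b\<in>multiplicative_solutions k B. \<Sum>(D, j)\<in>pairs \<times> c ` B. f b D j)"
    unfolding weighted_energy_eq_mixed_energy mixed_energy_def by (rule sum_mono)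
  also have "\<dots> = (\<Sum>(D, j)\<in>pairs \<times> c ` B.
      mixed_energy k (\<lambda>i. if i \<in> D then class_weight c j w else w) B)"
    unfolding mixed_energy_def f_def by (subst sum.swap) (simp add: case_prod_unfold)
  finally show ?thesis by (simp add: pairs_def sum.cartesian_product)
qed

lemma card_pairs_le: "real (card {D. D \<subseteq> {..<2*k} \<and> card D = 2}) \<le> 2 * real k ^ 2"
proof -
  have "card {D. D \<subseteq> {..<2*k} \<and> card D = 2} = 2 * k * (2 * k - 1) div 2"
    by (simp add: n_subsets choose_two)
  also have "\<dots> \<le> 2 * k ^ 2" by (simp add: power2_eq_square)
  finally show ?thesis by (simp flip: of_nat_power of_nat_mult add: of_nat_le_iff)
qed

context log_embedding
begin

lemma mixed_energy_class_weight_le: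
  assumes B: "finite B" "B \<subseteq> S" and k: "1 \<le> k" and w: "\<And>b. b \<in> B \<Longrightarrow> 0 \<le> w b"
    and j: "j \<in> c ` B" and M: "0 \<le> M" "Lambda_const k {b \<in> B. c b = j} \<le> M"
    and D: "D \<subseteq> {..<2*k}" "card D = 2"
    and R: "0 \<le> R" "R ^ k = weighted_energy k w B"
  shows "mixed_energy k (\<lambda>i. if i \<in> D then class_weight c j w else w) B \<le>
    M * (\<Sum>b | b \<in> B \<and> c b = j. (w b)\<^sup>2) * R ^ (k - 1)" (is "?E \<le> M * ?s * _")
proof -
  have s: "0 \<le> ?s" by (intro sum_nonneg) simp
  have "weighted_energy k (class_weight c j w) B \<le> (Lambda_const k {b \<in> B. c b = j} * ?s) ^ k"
    unfolding class_weight_def weighted_energy_restrict[OF B(1)]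
    using B(1) k w by (intro weighted_energy_le_Lambda_const) auto
  also have "\<dots> \<le> (M * ?s) ^ k"
    using B(1) j s M
    by (intro power_mono mult_right_mono mult_nonneg_nonneg Lambda_const_nonneg) auto
  finally have class_energy: "weighted_energy k (class_weight c j w) B \<le> (M * ?s) ^ k" .
  have "\<bar>?E\<bar> ^ k \<le> weighted_energy k (class_weight c j w) B * (R ^ k) ^ (k - 1)"
    unfolding R(2) by (rule mixed_energy_Hoelder[OF B k D])
  also have "\<dots> \<le> (M * ?s) ^ k * (R ^ k) ^ (k - 1)"
    using class_energy R(1) by (intro mult_right_mono) auto
  also have "\<dots> = (M * ?s * R ^ (k - 1)) ^ k"
    by (simp add: power_mult_distrib power_mult[symmetric] mult.commute)
  finally have "\<bar>?E\<bar> ^ k \<le> (M * ?s * R ^ (k - 1)) ^ k" .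
  then have "\<bar>?E\<bar> \<le> M * ?s * R ^ (k - 1)"
    using M(1) s R(1) k by (simp add: power_mono_iff)
  then show ?thesis by simp
qed

theorem Lambda_const_le_colour_classes:
  assumes k: "1 \<le> k" and B: "finite B" "B \<noteq> {}" "B \<subseteq> S"
    and repeated: "\<And>b. b \<in> multiplicative_solutions k B \<Longrightarrow> \<not> inj_on (\<lambda>i. c (b i)) {..<2*k}"
    and classes: "\<And>j. j \<in> c ` B \<Longrightarrow> Lambda_const k {b \<in> B. c b = j} \<le> M"
  shows "Lambda_const k B \<le> 2 * real k ^ 2 * M"
proof -
  obtain b where "b \<in> B" using B(2) by blast
  then have "0 \<le> Lambda_const k {b' \<in> B. c b' = c b}"
    using B(1) by (intro Lambda_const_nonneg) auto
  then have M: "0 \<le> M" using classes[of "c b"] \<open>b \<in> B\<close> by simp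
  show ?thesis
  proof (rule Lambda_const_leI[OF B(1,2) k])
    fix w assume unit: "w \<in> unit_weights B"
    then have w: "\<And>b. b \<in> B \<Longrightarrow> 0 \<le> w b" by (simp add: unit_weights_def)
    define R where "R = root k (weighted_energy k w B)"
    have R: "0 \<le> R" "R ^ k = weighted_energy k w B"
      using k weighted_energy_nonneg[of B w k] w unfolding R_def by auto
    let ?pairs = "{D. D \<subseteq> {..<2*k} \<and> card D = 2}"
    have "R * R ^ (k - 1) = weighted_energy k w B" using R(2) k by (simp add: power_eq_if)
    also have "\<dots> \<le> (\<Sum>D\<in>?pairs. \<Sum>j\<in>c ` B.
        mixed_energy k (\<lambda>i. if i \<in> D then class_weight c j w else w) B)"
      by (rule weighted_energy_le_sum_mixed_energy[OF B(1) w repeated])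
    also have "\<dots> \<le> (\<Sum>D\<in>?pairs. \<Sum>j\<in>c ` B. M * (\<Sum>b | b \<in> B \<and> c b = j. (w b)\<^sup>2) * R ^ (k - 1))"
      using M classes by (intro sum_mono mixed_energy_class_weight_le B k w R) auto
    also have "\<dots> = real (card ?pairs) * (M * R ^ (k - 1))"
    proof -
      have "(\<Sum>j\<in>c ` B. \<Sum>b | b \<in> B \<and> c b = j. (w b)\<^sup>2) = 1"
        using unit sum.image_gen[OF B(1), of "\<lambda>b. (w b)\<^sup>2" c] by (simp add: unit_weights_def)
      then show ?thesis
        by (simp flip: sum_distrib_left sum_distrib_right)
    qed
    also have "\<dots> \<le> 2 * real k ^ 2 * (M * R ^ (k - 1))"
      using M R(1) by (intro mult_right_mono card_pairs_le) auto
    finally have "R * R ^ (k - 1) \<le> (2 * real k ^ 2 * M) * R ^ (k - 1)" by (simp add: mult_ac)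
    then have "R \<le> 2 * real k ^ 2 * M" using R(1) M by (cases "R = 0") auto
    then show "weighted_energy k w B \<le> (2 * real k ^ 2 * M) ^ k"
      using R by (metis power_mono)
  qed (use M in simp)
qed

end

definition signed_exponents :: "int \<Rightarrow> (int \<Rightarrow> rat) \<times> bit" where
  "signed_exponents a = (prime_exponents a, of_bool (a < 0))"

interpretation int_embedding: log_embedding "{a. a \<noteq> 0}" signed_exponents
proof
  fix a b :: int assume "a \<in> {a. a \<noteq> 0}" "b \<in> {a. a \<noteq> 0}"
  then show "signed_exponents (a * b) = signed_exponents a + signed_exponents b"
    by (auto simp: signed_exponents_def prime_exponents_mult mult_less_0_iff)
next
  show "inj_on signed_exponents {a. a \<noteq> 0}"
  proof (rule inj_onI)
    fix a b :: int assume ab: "a \<in> {a. a \<noteq> 0}" "b \<in> {a. a \<noteq> 0}"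
      "signed_exponents a = signed_exponents b"
    then have "\<bar>a\<bar> = \<bar>b\<bar>"
      using prime_exponents_eq_imp_normalize_eq[of a b] by (simp add: signed_exponents_def)
    moreover have "a < 0 \<longleftrightarrow> b < 0" using ab(3) by (simp add: signed_exponents_def of_bool_eq_iff)
    ultimately show "a = b" by arith
  qed
qed auto

subsection \<open>Shifts and valuations\<close>

lemma dvd_prod_shift_diff:
  fixes a :: "'i \<Rightarrow> 'a::comm_ring_1"
  assumes "\<And>i. i \<in> I \<Longrightarrow> m dvd a i"
  shows "m dvd (\<Prod>i\<in>I. a i + u) - u ^ card I"
  using assms
proof (induction I rule: infinite_finite_induct)
  case (insert i I)
  have "(\<Prod>i\<in>insert i I. a i + u) - u ^ card (insert i I) =
      a i * (\<Prod>i\<in>I. a i + u) + u * ((\<Prod>i\<in>I. a i + u) - u ^ card I)"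
    using insert.hyps by (simp add: algebra_simps)
  then show ?case using insert by simp
qed simp_all

lemma prod_shift_neq_if_unique_min_multiplicity:
  fixes a :: "'i \<Rightarrow> 'a::factorial_ring_gcd"
  assumes fin: "finite I" "finite J" and card: "card I = card J" and r: "r \<in> I" "a r \<noteq> 0"
    and p: "prime p" "coprime u p"
    and min: "\<And>i. i \<in> (I - {r}) \<union> J \<Longrightarrow> multiplicity p (a r) < multiplicity p (a i)"
  shows "(\<Prod>i\<in>I. a i + u) \<noteq> (\<Prod>i\<in>J. a i + u)"
proof
  assume eq: "(\<Prod>i\<in>I. a i + u) = (\<Prod>i\<in>J. a i + u)"
  define m where "m = p ^ Suc (multiplicity p (a r))"
  have dvd: "m dvd a i" if "i \<in> (I - {r}) \<union> J" for i
    unfolding m_def using min[OF that] by (intro multiplicity_dvd') simp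
  define P where "P = (\<Prod>i\<in>I - {r}. a i + u)"
  have others: "m dvd P - u ^ card (I - {r})"
    unfolding P_def by (intro dvd_prod_shift_diff dvd) simp
  have "(\<Prod>i\<in>J. a i + u) = (a r + u) * P"
    unfolding P_def eq[symmetric] using fin(1) r(1) by (rule prod.remove)
  moreover have "card J = Suc (card (I - {r}))"
    using card.remove[OF fin(1) r(1)] card by simp
  moreover have "m dvd (\<Prod>i\<in>J. a i + u) - u ^ card J"
    by (intro dvd_prod_shift_diff dvd) simp
  ultimately have "m dvd (a r + u) * P - u * u ^ card (I - {r})" by simp
  then have "m dvd ((a r + u) * P - u * u ^ card (I - {r})) - (a r + u) * (P - u ^ card (I - {r}))"
    using dvd_mult[OF others] by (rule dvd_diff)
  then have "m dvd a r * u ^ card (I - {r})" by (simp add: algebra_simps)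
  moreover have "coprime m (u ^ card (I - {r}))"
    using p(2) by (simp add: m_def coprime_commute)
  ultimately have "m dvd a r" by (simp add: coprime_dvd_mult_left_iff)
  then show False
    using p(1) r(2) power_dvd_iff_le_multiplicity[of "a r" p "Suc (multiplicity p (a r))"]
    by (auto simp: m_def)
qed

lemma multiplicity_not_inj_on_if_prod_shift_eq:
  fixes a :: "'i \<Rightarrow> 'a::factorial_ring_gcd"
  assumes fin: "finite I" "finite J" and card: "card I = card J" and disjoint: "I \<inter> J = {}" "I \<noteq> {}"
    and a: "\<And>i. i \<in> I \<union> J \<Longrightarrow> a i \<noteq> 0 \<and> coprime u (a i)" and p: "prime p"
    and eq: "(\<Prod>i\<in>I. a i + u) = (\<Prod>i\<in>J. a i + u)"
  shows "\<not> inj_on (\<lambda>i. multiplicity p (a i)) (I \<union> J)"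
proof
  assume inj: "inj_on (\<lambda>i. multiplicity p (a i)) (I \<union> J)"
  obtain r where r: "r \<in> I \<union> J" "\<And>i. i \<in> I \<union> J \<Longrightarrow> multiplicity p (a r) \<le> multiplicity p (a i)"
    using ex_is_arg_min_if_finite[of "I \<union> J" "\<lambda>i. multiplicity p (a i)"] fin disjoint(2)
    by (auto simp: is_arg_min_linorder)
  have min: "multiplicity p (a r) < multiplicity p (a i)" if "i \<in> I \<union> J - {r}" for i
    using r that inj by (auto simp: inj_on_def order.strict_iff_order)
  have "J \<noteq> {}" using card fin disjoint(2) by auto
  then obtain i where i: "i \<in> I \<union> J" "i \<noteq> r" using disjoint by blast
  then have "p dvd a i" using min[of i] not_dvd_imp_multiplicity_0 by fastforce
  then have "\<not> p dvd u"
    using a[OF i(1)] p coprime_common_divisor[of u "a i" p] not_prime_unit by blast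
  then have "coprime u p" using p prime_imp_coprime coprime_commute by blast
  then show False
    using r(1) a eq min disjoint(1)
      prod_shift_neq_if_unique_min_multiplicity[OF fin card _ _ p, of r a u]
      prod_shift_neq_if_unique_min_multiplicity[OF fin(2,1) card[symmetric] _ _ p, of r a u]
    by auto
qed

lemma solution_exponents_not_inj_on:
  fixes A :: "'a::factorial_ring_gcd set"
  assumes k: "1 \<le> k" and A: "\<And>a. a \<in> A \<Longrightarrow> a \<noteq> 0 \<and> coprime u a"
    and b: "b \<in> multiplicative_solutions k (shift_set A u)"
  shows "\<not> inj_on (\<lambda>i. prime_exponents (b i - u) p) {..<2*k}"
proof (cases "prime p")
  case True
  have halves: "{..<k} \<union> {k..<2*k} = {..<2*k}" by auto
  have "b i - u \<noteq> 0 \<and> coprime u (b i - u)" if "i < 2 * k" for i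
    using multiplicative_solutions_mem[OF b that] by (intro A) (auto simp: shift_set_def)
  moreover have "(\<Prod>i<k. b i - u + u) = (\<Prod>i=k..<2*k. b i - u + u)"
    using b by (simp add: multiplicative_solutions_def)
  ultimately have "\<not> inj_on (\<lambda>i. multiplicity p (b i - u)) ({..<k} \<union> {k..<2*k})"
    using k True
    by (intro multiplicity_not_inj_on_if_prod_shift_eq[where u = u])
      (simp_all add: halves lessThan_empty_iff ivl_disj_int)
  then show ?thesis unfolding halves using True by (simp add: prime_exponents_def inj_on_def)
next
  case False
  then show ?thesis
    using k inj_onD[of "\<lambda>_. 0 :: rat" "{..<2*k}" 0 1] by (auto simp: prime_exponents_def)
qed

lemma shift_set_filter:
  fixes A :: "'a::group_add set"
  shows "{b \<in> shift_set A u. Q (b - u)} = shift_set {a \<in> A. Q a} u"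
  unfolding shift_set_def by auto

lemma inj_on_restrict_fibre:
  assumes "inj_on (\<lambda>a. restrict (f a) (insert p P)) A"
  shows "inj_on (\<lambda>a. restrict (f a) P) {a \<in> A. f a p = j}"
proof (rule inj_onI)
  fix a b assume ab: "a \<in> {a \<in> A. f a p = j}" "b \<in> {a \<in> A. f a p = j}"
    and eq: "restrict (f a) P = restrict (f b) P"
  have "restrict (f a) (insert p P) = restrict (f b) (insert p P)"
  proof (rule restrict_ext)
    fix q assume "q \<in> insert p P"
    then show "f a q = f b q"
      using ab fun_cong[OF eq, of q] by (cases "q = p") auto
  qed
  then show "a = b" by (rule inj_onD[OF assms]) (use ab in simp_all)
qed

lemma Lambda_const_shift_set_le_separating:
  fixes A :: "int set"
  assumes "finite P" and k: "1 \<le> k"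
    and "finite A" "A \<noteq> {}" "\<And>a. a \<in> A \<Longrightarrow> a \<noteq> 0 \<and> coprime u a" "0 \<notin> shift_set A u"
    and "inj_on (\<lambda>a. restrict (prime_exponents a) P) A"
  shows "Lambda_const k (shift_set A u) \<le> (2 * real k ^ 2) ^ card P"
  using assms(1,3-)
proof (induction P arbitrary: A)
  case empty
  obtain a where "a \<in> A" using empty.prems(2) by blast
  moreover have "b = a" if "b \<in> A" for b
    using inj_onD[OF empty.prems(5) _ that \<open>a \<in> A\<close>] by simp
  ultimately have "A = {a}" by blast
  then show ?case using Lambda_const_le_card[of "{a + u}" k] k by (simp add: shift_set_def)
next
  case (insert p P)
  let ?exponent = "\<lambda>b. prime_exponents (b - u) p"
  have classes: "Lambda_const k {b \<in> shift_set A u. ?exponent b = j} \<le> (2 * real k ^ 2) ^ card P"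
    if "j \<in> ?exponent ` shift_set A u" for j
    unfolding shift_set_filter[where Q = "\<lambda>a. prime_exponents a p = j"]
  proof (rule insert.IH[OF _ _ _ _ inj_on_restrict_fibre[OF insert.prems(5)]])
    show "{a \<in> A. prime_exponents a p = j} \<noteq> {}" "0 \<notin> shift_set {a \<in> A. prime_exponents a p = j} u"
      using that insert.prems(4) unfolding shift_set_def by auto
  qed (use insert.prems(1,3) in simp_all)
  have "Lambda_const k (shift_set A u) \<le> 2 * real k ^ 2 * (2 * real k ^ 2) ^ card P"
  proof (rule int_embedding.Lambda_const_le_colour_classes[OF k _ _ _ _ classes])
    show "finite (shift_set A u)" "shift_set A u \<noteq> {}"
      using insert.prems(1,2) by (simp_all add: shift_set_def)
    show "shift_set A u \<subseteq> {b. b \<noteq> 0}" using insert.prems(4) by blast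
    show "\<not> inj_on (\<lambda>i. ?exponent (b i)) {..<2*k}"
      if "b \<in> multiplicative_solutions k (shift_set A u)" for b
      using k insert.prems(3) that by (rule solution_exponents_not_inj_on)
  qed
  then show ?case using insert.hyps by simp
qed

theorem Lambda_const_shift_set_le:
  fixes A :: "int set"
  assumes A: "finite A" "A \<noteq> {}" "\<And>a. a \<in> A \<Longrightarrow> 0 < a" and k: "1 \<le> k"
    and u: "\<And>a. a \<in> A \<Longrightarrow> coprime u a" "0 \<notin> shift_set A u"
  shows "Lambda_const k (shift_set A u) \<le> (2 * real k ^ 2) ^ int_log.mult_dim A"
proof -
  obtain P where P: "finite P" "card P \<le> int_log.mult_dim A"
    "inj_on (\<lambda>a. restrict (prime_exponents a) P) A"
    using obtain_separating_primes[OF A(1,3)] by blast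
  have "1 \<le> real k ^ 2" using k by simp
  have "Lambda_const k (shift_set A u) \<le> (2 * real k ^ 2) ^ card P"
    using A u P by (intro Lambda_const_shift_set_le_separating k) force+
  also have "\<dots> \<le> (2 * real k ^ 2) ^ int_log.mult_dim A"
    using P(2) \<open>1 \<le> real k ^ 2\<close> by (intro power_increasing) auto
  finally show ?thesis .
qed

lemma card_shift_set:
  fixes u :: "'a::cancel_semigroup_add"
  shows "card (shift_set A u) = card A"
  unfolding shift_set_def by (intro card_image) (auto simp: inj_on_def)

lemma card_iterated_product_shift_set_ge_if_zero_free:
  fixes A :: "int set"
  assumes A: "finite A" "A \<noteq> {}" "\<And>a. a \<in> A \<Longrightarrow> 0 < a" and k: "1 \<le> k"
    and u: "\<And>a. a \<in> A \<Longrightarrow> coprime u a" "0 \<notin> shift_set A u"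
  shows "real (card A) ^ k \<le> real (card (iterated_product_set (shift_set A u) k)) *
    (2 * real k ^ 2) ^ (k * int_log.mult_dim A)"
proof -
  let ?B = "shift_set A u" and ?d = "int_log.mult_dim A"
  have B: "finite ?B" "?B \<noteq> {}" using A(1,2) by (simp_all add: shift_set_def)
  have "real (card A) ^ k \<le> real (card (iterated_product_set ?B k)) * Lambda_const k ?B ^ k"
    using card_iterated_product_set_ge[OF B k] by (simp add: card_shift_set)
  also have "\<dots> \<le> real (card (iterated_product_set ?B k)) * ((2 * real k ^ 2) ^ ?d) ^ k"
    using Lambda_const_nonneg[OF B] Lambda_const_shift_set_le[OF A k u]
    by (intro mult_left_mono power_mono) auto
  finally show ?thesis by (simp only: power_mult[symmetric] mult.commute[of ?d])
qed

lemma iterated_product_set_mono: "B \<subseteq> C \<Longrightarrow> iterated_product_set B k \<subseteq> iterated_product_set C k"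
  unfolding iterated_product_set_def by blast

text \<open>
  Zero may lie in the shifted set; removing it costs at most a factor \<open>2 ^ k\<close>, which the extra
  factor \<open>2 k\<^sup>2\<close> in the base absorbs.
\<close>
theorem card_iterated_product_shift_set_ge:
  fixes A :: "int set"
  assumes A: "2 \<le> card A" "\<And>a. a \<in> A \<Longrightarrow> 0 < a" and k: "1 \<le> k"
    and u: "\<And>a. a \<in> A \<Longrightarrow> coprime u a"
  shows "real (card A) ^ k \<le> real (card (iterated_product_set (shift_set A u) k)) *
    (2 * real k ^ 2) ^ (k * Suc (int_log.mult_dim A))"
proof -
  define A' where "A' = A - {- u}"
  define c where "c = 2 * real k ^ 2"
  let ?d = "int_log.mult_dim A"
  have "finite A" using A(1) by (intro card_ge_0_finite) simp
  then have A': "A' \<subseteq> A" "finite A'" "0 \<notin> shift_set A' u"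
    unfolding A'_def shift_set_def by auto
  have "1 \<le> real k ^ 2" using k by simp
  then have c: "2 \<le> c" by (simp add: c_def)
  have "card A \<le> Suc (card A')"
    unfolding A'_def using \<open>finite A\<close> by (cases "- u \<in> A") (auto simp: card_Diff_singleton)
  then have card_A: "card A \<le> 2 * card A'" "A' \<noteq> {}" using A(1) by auto
  have "real (card A') ^ k \<le>
      real (card (iterated_product_set (shift_set A' u) k)) * c ^ (k * int_log.mult_dim A')"
    unfolding c_def using A' A(2) card_A(2) k u
    by (intro card_iterated_product_shift_set_ge_if_zero_free) auto
  also have "\<dots> \<le> real (card (iterated_product_set (shift_set A u) k)) * c ^ (k * ?d)"
  proof (intro mult_mono power_increasing)
    have "iterated_product_set (shift_set A' u) k \<subseteq> iterated_product_set (shift_set A u) k"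
      using A'(1) by (intro iterated_product_set_mono) (auto simp: shift_set_def)
    moreover have "finite (iterated_product_set (shift_set A u) k)"
      using \<open>finite A\<close> by (intro finite_iterated_product_set) (simp add: shift_set_def)
    ultimately show "real (card (iterated_product_set (shift_set A' u) k)) \<le>
        real (card (iterated_product_set (shift_set A u) k))"
      by (simp add: card_mono)
  qed (use c int_log.mult_dim_mono[OF \<open>finite A\<close> A'(1)] in auto)
  finally have A'_bound: "real (card A') ^ k \<le>
      real (card (iterated_product_set (shift_set A u) k)) * c ^ (k * ?d)" .
  have "real (card A) ^ k \<le> (2 * real (card A')) ^ k"
    using card_A(1) by (intro power_mono) linarith+
  also have "\<dots> \<le> c ^ k * real (card A') ^ k"
    unfolding power_mult_distrib using c by (intro mult_right_mono power_mono) auto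
  also have "\<dots> \<le> c ^ k * (real (card (iterated_product_set (shift_set A u) k)) * c ^ (k * ?d))"
    using A'_bound c by (intro mult_left_mono) auto
  finally show ?thesis by (simp add: power_add mult_ac flip: c_def)
qed

theorem theorem10:
  fixes K :: int
  shows "\<exists>N0::nat. \<forall>A::int set.
    finite A \<longrightarrow> (\<forall>a\<in>A. 0 < a) \<longrightarrow>
    int (card (product_set A)) \<le> K * int (card A) \<longrightarrow> N0 \<le> card A \<longrightarrow>
    (\<forall>k::nat. 1 \<le> k \<longrightarrow>
      (\<forall>u::int. (\<forall>a\<in>A. coprime u a) \<longrightarrow>
        (0 \<notin> shift_set A u \<longrightarrow>
           Lambda_const k (shift_set A u) \<le> (2 * real k ^ 2) powi K) \<and>
        real (card (iterated_product_set (shift_set A u) k))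
          \<ge> real (card A) ^ k / (2 * real k ^ 2) powi (int k * K)))"
proof (intro exI[of _ "nat (2 * K\<^sup>2 + 2)"] allI impI conjI)
  fix A :: "int set" and k :: nat and u :: int
  assume A: "finite A" "\<forall>a\<in>A. 0 < a" and doubling: "int (card (product_set A)) \<le> K * int (card A)"
    and large: "nat (2 * K\<^sup>2 + 2) \<le> card A" and k: "1 \<le> k" and u: "\<forall>a\<in>A. coprime u a"
  define c where "c = 2 * real k ^ 2"
  let ?d = "int_log.mult_dim A" and ?P = "iterated_product_set (shift_set A u) k"
  have card_A: "2 * K\<^sup>2 < int (card A)" "2 \<le> card A"
    using large zero_le_power2[of K] by linarith+
  have d: "int ?d < K" using A doubling card_A by (intro int_log.mult_dim_less_doubling) auto
  have "1 \<le> real k ^ 2" using k by simp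
  then have c: "1 \<le> c" by (simp add: c_def)
  have power_le: "c ^ n \<le> c powi m" if "int n \<le> m" for n m
    using power_int_increasing[OF that c] c by simp
  show "Lambda_const k (shift_set A u) \<le> (2 * real k ^ 2) powi K" if "0 \<notin> shift_set A u"
  proof (rule order.trans)
    show "Lambda_const k (shift_set A u) \<le> c ^ ?d"
      unfolding c_def using A k u that card_A(2) by (intro Lambda_const_shift_set_le) auto
  qed (use d power_le in \<open>simp flip: c_def\<close>)
  have "real (card A) ^ k \<le> real (card ?P) * c ^ (k * Suc ?d)"
    unfolding c_def using A k u card_A(2) by (intro card_iterated_product_shift_set_ge) auto
  also have "\<dots> \<le> real (card ?P) * c powi (int k * K)"
    using mult_left_mono[of "int (Suc ?d)" K "int k"] d
    by (intro mult_left_mono power_le) (simp_all add: algebra_simps)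
  finally show "real (card A) ^ k / (2 * real k ^ 2) powi (int k * K) \<le> real (card ?P)"
    using c by (simp add: pos_divide_le_eq flip: c_def)
qed

end
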